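(* For each integer $n\ge1$ and each $\chi\in\mathcal{O}_1$, $Q_n^\chi$ is an indecomposable $H_\lambda$-module of dimension $n$.
   Context: $\Bbbk$ is an algebraically closed field of characteristic zero, $N,M\ge2$ are integers, $\lambda=(\lambda_1,\lambda_2,\lambda_3)\in\Bbbk^3$, $\Gamma=\langle g_1,g_2: g_1g_2=g_2g_1,\ g_1^{2N}=g_2^{2M}=1\rangle$. $H_\lambda$ is the algebra generated by $\Gamma$ and $a_1,a_2$ with relations $g_1a_1=-a_1g_1$, $g_1a_2=-a_2g_1$, $g_2a_1=a_1g_2$, $g_2a_2=-a_2g_2$, $a_1^2=\lambda_1(1-g_1^2)$, $a_2^2=\lambda_2(1-g_2^2)$, $a_1a_2a_1a_2+a_2a_1a_2a_1=\lambda_3(1-g_1^2g_2^2)-2\lambda_1\lambda_2(1+g_2^2)(1-g_1^2)$. $\mathcal{O}=\mathbb{G}_{2N}\times\mathbb{G}_{2M}$, where $\mathbb{G}_n\subset\Bbbk$ is the group of $n$th roots of 1. For $\chi=(\chi_1,\chi_2)\in\mathcal{O}$, a vector $v$ is of type $\chi$ if $g_iv=\chi_iv$, $i=1,2$; $\bar\chi=(-\chi_1,\chi_2)$, $-\chi=(-\chi_1,-\chi_2)$, $-\bar\chi=(\chi_1,-\chi_2)$. $\mathcal{O}_1$ is the set of $\chi\in\mathcal{O}$ with $\lambda_1(1-\chi_1^2)=0$, $\lambda_2(1-\chi_2^2)=0$ and $\lambda_3(1-\chi_1^2\chi_2^2)-2\lambda_1\lambda_2(1+\chi_2^2)(1-\chi_1^2)=0$.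 For $\chi\in\mathcal{O}_1$ and $n=4k$, $Q_n^\chi$ has ordered basis $x_{1,1},x_{2,1},x_{3,1},x_{4,1},x_{1,2},x_{2,2},\dots,x_{1,k},x_{2,k},x_{3,k},x_{4,k}$, where $x_{1,j},x_{2,j},x_{3,j},x_{4,j}$ are of types $\chi,\bar\chi,-\bar\chi,-\chi$ respectively, and, with $x_{1,k+1}:=0$, for $1\le j\le k$: $a_1x_{1,j}=a_2x_{1,j}=0$; $a_1x_{2,j}=x_{1,j}$, $a_2x_{2,j}=0$; $a_1x_{3,j}=0$, $a_2x_{3,j}=x_{2,j}$; $a_1x_{4,j}=x_{3,j}$, $a_2x_{4,j}=x_{1,j+1}$. If $n=4k+r$ with $k\ge0$ and $1\le r\le3$, $Q_n^\chi$ is the submodule of $Q_{4(k+1)}^\chi$ generated by the first $n$ elements of the ordered basis. *)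

theory Defs
  imports
    "HOL-Computational_Algebra.Polynomial"
    "HOL-Algebra.QuotRing"
    "HOL-Library.Poly_Mapping"
    "HOL-Library.Product_Plus"
begin

section \<open>Modules over an associative algebra\<close>

locale assoc_algebra =
  Ring.ring A for A :: "('a, 'm) ring_scheme" (structure) +
  fixes \<eta> :: "'k::field \<Rightarrow> 'a"
  assumes unit_closed: "\<eta> c \<in> carrier A"
    and unit_add: "\<eta> (c + d) = \<eta> c \<oplus> \<eta> d"
    and unit_mult: "\<eta> (c * d) = \<eta> c \<otimes> \<eta> d"
    and unit_one: "\<eta> 1 = \<one>"
    and unit_central: "a \<in> carrier A \<Longrightarrow> \<eta> c \<otimes> a = a \<otimes> \<eta> c"

text \<open>
  A left module over the algebra \<open>(A, \<eta>)\<close> whose underlying vector space is a subspace \<open>V\<close> of an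
  ambient vector space with scalar multiplication \<open>scale\<close>. (The module locale of HOL-Algebra
  requires a commutative ring.)
\<close>

locale algebra_module =
  assoc_algebra A \<eta> + vector_space scale
  for A :: "('a, 'm) ring_scheme" (structure) and \<eta> :: "'k::field \<Rightarrow> 'a"
    and scale :: "'k \<Rightarrow> 'v::ab_group_add \<Rightarrow> 'v" +
  fixes V :: "'v set" and act :: "'a \<Rightarrow> 'v \<Rightarrow> 'v"
  assumes subspace_V: "subspace V"
    and act_closed: "a \<in> carrier A \<Longrightarrow> v \<in> V \<Longrightarrow> act a v \<in> V"
    and act_add_right:
      "a \<in> carrier A \<Longrightarrow> v \<in> V \<Longrightarrow> w \<in> V \<Longrightarrow> act a (v + w) = act a v + act a w"
    and act_add_left:
      "a \<in> carrier A \<Longrightarrow> b \<in> carrier A \<Longrightarrow> v \<in> V \<Longrightarrow> act (a \<oplus> b) v = act a v + act b v"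
    and act_mult:
      "a \<in> carrier A \<Longrightarrow> b \<in> carrier A \<Longrightarrow> v \<in> V \<Longrightarrow> act (a \<otimes> b) v = act a (act b v)"
    and act_unit: "v \<in> V \<Longrightarrow> act (\<eta> c) v = scale c v"

definition submodule ::
    "('a, 'm) ring_scheme \<Rightarrow> ('k::field \<Rightarrow> 'v::ab_group_add \<Rightarrow> 'v) \<Rightarrow> 'v set \<Rightarrow> ('a \<Rightarrow> 'v \<Rightarrow> 'v) \<Rightarrow>
      'v set \<Rightarrow> bool" where
  "submodule A scale V act W \<longleftrightarrow>
    W \<subseteq> V \<and> module.subspace scale W \<and> (\<forall>a\<in>carrier A. \<forall>w\<in>W. act a w \<in> W)"

definition generated_submodule ::
    "('a, 'm) ring_scheme \<Rightarrow> ('k::field \<Rightarrow> 'v::ab_group_add \<Rightarrow> 'v) \<Rightarrow> 'v set \<Rightarrow> ('a \<Rightarrow> 'v \<Rightarrow> 'v) \<Rightarrow>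
      'v set \<Rightarrow> 'v set" where
  "generated_submodule A scale V act S = \<Inter>{W. submodule A scale V act W \<and> S \<subseteq> W}"

definition indecomposable ::
    "('a, 'm) ring_scheme \<Rightarrow> ('k::field \<Rightarrow> 'v::ab_group_add \<Rightarrow> 'v) \<Rightarrow> 'v set \<Rightarrow> ('a \<Rightarrow> 'v \<Rightarrow> 'v) \<Rightarrow>
      bool" where
  "indecomposable A scale V act \<longleftrightarrow>
    V \<noteq> {0} \<and>
    (\<forall>U W. submodule A scale V act U \<longrightarrow> submodule A scale V act W \<longrightarrow>
      U \<inter> W = {0} \<longrightarrow> {u + w | u w. u \<in> U \<and> w \<in> W} = V \<longrightarrow> U = {0} \<or> W = {0})"


section \<open>The free algebra on four generators\<close>

datatype gen = G1 | G2 | A1 | A2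

datatype free_monoid = Word "gen list"

instantiation free_monoid :: monoid_add
begin

definition zero_free_monoid :: free_monoid where
  "0 = Word []"

fun plus_free_monoid :: "free_monoid \<Rightarrow> free_monoid \<Rightarrow> free_monoid" where
  "Word u + Word w = Word (u @ w)"

instance
proof
  fix u v w :: free_monoid
  show "u + v + w = u + (v + w)" by (cases u; cases v; cases w) simp
  show "0 + u = u" by (cases u) (simp add: zero_free_monoid_def)
  show "u + 0 = u" by (cases u) (simp add: zero_free_monoid_def)
qed

end

text \<open>
  The monoid is written additively so that the convolution product of \<open>Poly_Mapping\<close> makes
  the finitely supported functions on words into the free (noncommutative) algebra.
\<close>

type_synonym 'k free_algebra = "free_monoid \<Rightarrow>\<^sub>0 'k"

definition free_ring :: "'k::field free_algebra Ring.ring" where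
  "free_ring = \<lparr>carrier = UNIV, monoid.mult = (*), one = 1, zero = 0, add = (+)\<rparr>"

definition gen_elt :: "gen \<Rightarrow> 'k::field free_algebra" where
  "gen_elt x = Poly_Mapping.single (Word [x]) 1"

definition const_elt :: "'k \<Rightarrow> 'k::field free_algebra" where
  "const_elt c = Poly_Mapping.single 0 c"


section \<open>The algebra \<open>H\<^sub>\<lambda>\<close>\<close>

text \<open>A relation \<open>l = r\<close> is represented by the element \<open>l - r\<close>.\<close>

definition relators :: "nat \<Rightarrow> nat \<Rightarrow> 'k \<times> 'k \<times> 'k \<Rightarrow> 'k::field free_algebra set" where
  "relators N M lam =
    (case lam of (l1, l2, l3) \<Rightarrow>
     let g1 = gen_elt G1; g2 = gen_elt G2; a1 = gen_elt A1; a2 = gen_elt A2 in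
      {g1 * g2 - g2 * g1,
       g1 ^ (2 * N) - 1,
       g2 ^ (2 * M) - 1,
       g1 * a1 - (- (a1 * g1)),
       g1 * a2 - (- (a2 * g1)),
       g2 * a1 - a1 * g2,
       g2 * a2 - (- (a2 * g2)),
       a1 ^ 2 - const_elt l1 * (1 - g1 ^ 2),
       a2 ^ 2 - const_elt l2 * (1 - g2 ^ 2),
       (a1 * a2 * a1 * a2 + a2 * a1 * a2 * a1) -
         (const_elt l3 * (1 - g1 ^ 2 * g2 ^ 2)
          - const_elt (2 * l1 * l2) * (1 + g2 ^ 2) * (1 - g1 ^ 2))})"

definition H_ideal :: "nat \<Rightarrow> nat \<Rightarrow> 'k \<times> 'k \<times> 'k \<Rightarrow> 'k::field free_algebra set" where
  "H_ideal N M lam = genideal free_ring (relators N M lam)"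

definition H_alg :: "nat \<Rightarrow> nat \<Rightarrow> 'k \<times> 'k \<times> 'k \<Rightarrow> 'k::field free_algebra set Ring.ring" where
  "H_alg N M lam = free_ring Quot (H_ideal N M lam)"

definition H_class ::
    "nat \<Rightarrow> nat \<Rightarrow> 'k \<times> 'k \<times> 'k \<Rightarrow> 'k::field free_algebra \<Rightarrow> 'k free_algebra set" where
  "H_class N M lam p = H_ideal N M lam +>\<^bsub>free_ring\<^esub> p"

definition H_unit :: "nat \<Rightarrow> nat \<Rightarrow> 'k \<times> 'k \<times> 'k \<Rightarrow> 'k::field \<Rightarrow> 'k free_algebra set" where
  "H_unit N M lam c = H_class N M lam (const_elt c)"


section \<open>Types\<close>

text \<open>The opposites \<open>- \<chi>\<close> and \<open>- bar_char \<chi>\<close> are given by negation on pairs.\<close>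

definition bar_char :: "'k \<times> 'k \<Rightarrow> 'k::field \<times> 'k" where
  "bar_char \<chi> = (- fst \<chi>, snd \<chi>)"

definition char_set :: "nat \<Rightarrow> nat \<Rightarrow> ('k::field \<times> 'k) set" where
  "char_set N M = {z. z ^ (2 * N) = 1} \<times> {z. z ^ (2 * M) = 1}"

definition char_set1 :: "nat \<Rightarrow> nat \<Rightarrow> 'k \<times> 'k \<times> 'k \<Rightarrow> ('k::field \<times> 'k) set" where
  "char_set1 N M lam =
    {\<chi> \<in> char_set N M. case lam of (l1, l2, l3) \<Rightarrow> case \<chi> of (c1, c2) \<Rightarrow>
      l1 * (1 - c1 ^ 2) = 0 \<and>
      l2 * (1 - c2 ^ 2) = 0 \<and>
      l3 * (1 - c1 ^ 2 * c2 ^ 2) - 2 * l1 * l2 * (1 + c2 ^ 2) * (1 - c1 ^ 2) = 0}"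


section \<open>The modules \<open>Q\<^sub>n\<^sup>\<chi>\<close>\<close>

text \<open>
  The ambient space consists of the finitely supported functions on pairs \<open>(i, j)\<close>; it has the
  vectors \<open>xvec i j\<close> as a basis.
\<close>

type_synonym 'k vect = "(nat \<times> nat) \<Rightarrow>\<^sub>0 'k"

definition vscale :: "'k \<Rightarrow> 'k vect \<Rightarrow> 'k::field vect" where
  "vscale c v = Poly_Mapping.map ((*) c) v"

lemma lookup_vscale [simp]: "Poly_Mapping.lookup (vscale c v) b = c * Poly_Mapping.lookup v b"
  by (cases "Poly_Mapping.lookup v b = 0") (simp_all add: vscale_def Poly_Mapping.map.rep_eq)

lemma vector_space_vscale: "vector_space (vscale :: 'k \<Rightarrow> 'k vect \<Rightarrow> 'k::field vect)"
  by unfold_locales (simp_all add: poly_mapping_eq_iff fun_eq_iff lookup_add algebra_simps)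

definition xvec :: "nat \<Rightarrow> nat \<Rightarrow> 'k::field vect" where
  "xvec i j = Poly_Mapping.single (i, j) 1"

text \<open>The ordered basis \<open>xvec 1 1, xvec 2 1, xvec 3 1, xvec 4 1, xvec 1 2, \<dots>\<close>, enumerated from \<open>m = 0\<close>.\<close>

definition basis_vec :: "nat \<Rightarrow> 'k::field vect" where
  "basis_vec m = xvec (m mod 4 + 1) (m div 4 + 1)"

definition x_type :: "'k \<times> 'k \<Rightarrow> nat \<Rightarrow> 'k::field \<times> 'k" where
  "x_type \<chi> i = (if i = 1 then \<chi> else if i = 2 then bar_char \<chi> else if i = 3 then - bar_char \<chi> else - \<chi>)"

text \<open>The image of \<open>xvec i j\<close> under a generator in \<open>Q\<^sub>4\<^sub>k\<^sup>\<chi>\<close>, for \<open>1 \<le> i \<le> 4\<close> and \<open>1 \<le> j \<le> k\<close>.\<close>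

fun gen_on_x :: "nat \<Rightarrow> 'k \<times> 'k \<Rightarrow> gen \<Rightarrow> nat \<times> nat \<Rightarrow> 'k::field vect" where
  "gen_on_x k \<chi> G1 (i, j) = vscale (fst (x_type \<chi> i)) (xvec i j)"
| "gen_on_x k \<chi> G2 (i, j) = vscale (snd (x_type \<chi> i)) (xvec i j)"
| "gen_on_x k \<chi> A1 (i, j) = (if i = 2 then xvec 1 j else if i = 4 then xvec 3 j else 0)"
| "gen_on_x k \<chi> A2 (i, j) =
    (if i = 3 then xvec 2 j else if i = 4 \<and> j < k then xvec 1 (j + 1) else 0)"

definition gen_op :: "nat \<Rightarrow> 'k \<times> 'k \<Rightarrow> gen \<Rightarrow> 'k vect \<Rightarrow> 'k::field vect" where
  "gen_op k \<chi> g v = (\<Sum>b\<in>Poly_Mapping.keys v. vscale (Poly_Mapping.lookup v b) (gen_on_x k \<chi> g b))"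

fun word_act :: "(gen \<Rightarrow> 'v \<Rightarrow> 'v) \<Rightarrow> free_monoid \<Rightarrow> 'v \<Rightarrow> 'v" where
  "word_act T (Word w) v = foldr T w v"

definition free_act :: "(gen \<Rightarrow> 'k vect \<Rightarrow> 'k vect) \<Rightarrow> 'k::field free_algebra \<Rightarrow> 'k vect \<Rightarrow> 'k vect" where
  "free_act T p v = (\<Sum>w\<in>Poly_Mapping.keys p. vscale (Poly_Mapping.lookup p w) (word_act T w v))"

text \<open>
  The action of a residue class of the free algebra on \<open>Q\<^sub>4\<^sub>k\<^sup>\<chi>\<close>. It is meaningful only if all
  representatives of the class \<open>X\<close> give the same result on \<open>v\<close>, i.e. if the generators
  satisfy the defining relations of \<open>H\<^sub>\<lambda>\<close> on \<open>Q\<^sub>4\<^sub>k\<^sup>\<chi>\<close>.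
\<close>

definition Q_act ::
    "nat \<Rightarrow> 'k \<times> 'k \<Rightarrow> 'k free_algebra set \<Rightarrow> 'k vect \<Rightarrow> 'k::field vect" where
  "Q_act k \<chi> X v = the_elem ((\<lambda>p. free_act (gen_op k \<chi>) p v) ` X)"

definition Q4_space :: "nat \<Rightarrow> 'k::field vect set" where
  "Q4_space k = module.span vscale (basis_vec ` {..<4 * k})"

text \<open>
  \<open>Q_blocks n\<close> is the \<open>k\<close> such that \<open>Q\<^sub>n\<^sup>\<chi>\<close> is defined as \<open>Q\<^sub>4\<^sub>k\<^sup>\<chi>\<close> or as a submodule of it; \<open>Q\<^sub>n\<^sup>\<chi>\<close>
  carries the action \<open>Q_act (Q_blocks n) \<chi>\<close>.
\<close>

definition Q_blocks :: "nat \<Rightarrow> nat" where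
  "Q_blocks n = (if n mod 4 = 0 then n div 4 else n div 4 + 1)"

definition Q_space ::
    "nat \<Rightarrow> nat \<Rightarrow> 'k \<times> 'k \<times> 'k \<Rightarrow> 'k \<times> 'k \<Rightarrow> nat \<Rightarrow> 'k::field vect set" where
  "Q_space N M lam \<chi> n =
    (if n mod 4 = 0 then Q4_space (n div 4)
     else generated_submodule (H_alg N M lam) vscale
            (Q4_space (n div 4 + 1)) (Q_act (n div 4 + 1) \<chi>) (basis_vec ` {..<n}))"

end

theory Submission
  imports Defs
begin

text \<open>
  Write \<open>b\<^sub>0, b\<^sub>1, \<dots>\<close> for the ordered basis. All defining relations of \<open>H\<^sub>\<lambda>\<close> already hold for the
  operators \<open>gen_op k \<chi>\<close> on the whole ambient space, and the span of \<open>b\<^sub>0, \<dots>, b\<^bsub>n-1\<^esub>\<close> is stable under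
  them. For indecomposability, split \<open>b\<^sub>m = u\<^sub>m + w\<^sub>m\<close> along a decomposition \<open>U \<oplus> W\<close>; the projection
  onto \<open>U\<close> commutes with the generators. The four types are pairwise distinct, so \<open>u\<^sub>m\<close> involves only
  basis vectors whose index is congruent to \<open>m\<close> modulo 4. Consecutive basis vectors are joined by
  \<open>a\<^sub>1\<close> or \<open>a\<^sub>2\<close>, so passing from \<open>m\<close> to \<open>m + 1\<close> shifts coefficients, and nothing is shifted into
  the position of \<open>b\<^sub>0\<close>. Hence \<open>u\<^sub>m\<close> is \<open>c b\<^sub>m\<close> plus later basis vectors, with \<open>c\<close> independent of \<open>m\<close>.
  Comparing leading coefficients, \<open>c = 0\<close> forces \<open>U = 0\<close> and \<open>c \<noteq> 0\<close> forces \<open>W = 0\<close>.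
\<close>

interpretation vs: vector_space vscale
  by (rule vector_space_vscale)

section \<open>The action of the free algebra\<close>

lemma free_act_superset:
  assumes "finite S" "Poly_Mapping.keys p \<subseteq> S"
  shows "free_act T p v = (\<Sum>w\<in>S. vscale (Poly_Mapping.lookup p w) (word_act T w v))"
  unfolding free_act_def using assms
  by (intro sum.mono_neutral_left) (auto simp: in_keys_iff)

lemma free_act_single: "free_act T (Poly_Mapping.single w c) v = vscale c (word_act T w v)"
  by (subst free_act_superset[of "{w}"]) auto

lemma free_act_zero [simp]: "free_act T 0 v = 0"
  by (simp add: free_act_def)

lemma free_act_add: "free_act T (p + q) v = free_act T p v + free_act T q v"
proof -
  let ?S = "Poly_Mapping.keys p \<union> Poly_Mapping.keys q"
  have "Poly_Mapping.keys (p + q) \<subseteq> ?S" by (rule keys_add)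
  then show ?thesis
    by (simp add: free_act_superset[of ?S] lookup_add vs.scale_left_distrib sum.distrib)
qed

lemma free_act_uminus: "free_act T (- p) v = - free_act T p v"
  using free_act_add[of T p "- p" v] by (simp add: eq_neg_iff_add_eq_0 add.commute)

lemma free_act_diff: "free_act T (p - q) v = free_act T p v - free_act T q v"
  using free_act_add[of T p "- q" v] by (simp add: free_act_uminus)

text \<open>Writing at a fresh key is adding a monomial, so identities additive in an element of the
  free algebra need checking on monomials only.\<close>

lemma poly_mapping_additive_induct [case_names zero single add]:
  fixes p :: "'a \<Rightarrow>\<^sub>0 'b::ab_group_add"
  assumes "P 0" "\<And>w c. P (Poly_Mapping.single w c)" "\<And>p q. P p \<Longrightarrow> P q \<Longrightarrow> P (p + q)"
  shows "P p"
proof (induction p rule: update_induct)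
  case const
  show ?case using assms(1) by simp
next
  case (update f a b)
  have "Poly_Mapping.update a b f = f + Poly_Mapping.single a b"
    using update.hyps(1)
    by (intro poly_mapping_eqI) (auto simp: lookup_update lookup_add lookup_single in_keys_iff when_def)
  then show ?case using assms update.IH by simp
qed

lemma word_act_zero [simp]: "word_act T 0 v = v"
  by (simp add: zero_free_monoid_def)

lemma word_act_plus: "word_act T (u + w) v = word_act T u (word_act T w v)"
  by (cases u; cases w) simp

lemma free_act_const_elt [simp]: "free_act T (const_elt c) v = vscale c v"
  by (simp add: const_elt_def free_act_single)

lemma free_act_one [simp]: "free_act T 1 v = v"
  using free_act_const_elt[of T 1 v] by (simp add: const_elt_def)

lemma free_act_gen_elt [simp]: "free_act T (gen_elt g) v = T g v"
  by (simp add: gen_elt_def free_act_single)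

context
  fixes T :: "gen \<Rightarrow> 'k vect \<Rightarrow> 'k::field vect"
  assumes lin: "\<And>g. Vector_Spaces.linear vscale vscale (T g)"
begin

lemma linear_word_act: "Vector_Spaces.linear vscale vscale (word_act T w)"
proof (cases w)
  case (Word l)
  have "Vector_Spaces.linear vscale vscale (foldr T l)"
  proof (induction l)
    case Nil
    then show ?case using vs.linear_id by (simp add: id_def)
  next
    case (Cons g l)
    then show ?case using Vector_Spaces.linear_compose[OF Cons lin[of g]] by (simp add: comp_def)
  qed
  moreover have "word_act T w = foldr T l" using Word by auto
  ultimately show ?thesis by simp
qed

lemma linear_free_act: "Vector_Spaces.linear vscale vscale (free_act T p)"
proof -
  interpret w: Vector_Spaces.linear vscale vscale "word_act T w" for w
    by (rule linear_word_act)
  show ?thesis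
    by unfold_locales
      (simp_all add: free_act_def w.add w.scale vs.scale_right_distrib sum.distrib
        vs.scale_sum_right mult.commute)
qed

text \<open>Both sides are additive in \<open>p\<close> and in \<open>q\<close>. On monomials,
  concatenating words composes their actions, and linearity moves the scalar of the right factor
  past the left word.\<close>

lemma free_act_mult: "free_act T (p * q) v = free_act T p (free_act T q v)"
proof (induction p rule: poly_mapping_additive_induct)
  case (single u c)
  interpret w: Vector_Spaces.linear vscale vscale "word_act T u"
    by (rule linear_word_act)
  show ?case
  proof (induction q rule: poly_mapping_additive_induct)
    case (single w d)
    show ?case by (simp add: mult_single free_act_single word_act_plus w.scale)
  next
    case (add q r)
    then show ?case
      by (simp add: distrib_left free_act_add free_act_single w.add vs.scale_right_distrib)
  qed (simp add: free_act_single)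
qed (simp_all add: distrib_right free_act_add)

lemma free_act_power: "free_act T (p ^ m) v = (free_act T p ^^ m) v"
  by (induction m) (simp_all add: free_act_mult)

lemma free_act_closed:
  assumes "vs.subspace W" "\<And>g w. w \<in> W \<Longrightarrow> T g w \<in> W" "v \<in> W"
  shows "free_act T p v \<in> W"
proof -
  have "foldr T l v \<in> W" for l by (induction l) (simp_all add: assms)
  then have "word_act T w v \<in> W" for w by (cases w) auto
  then show ?thesis
    unfolding free_act_def by (intro vs.subspace_sum vs.subspace_scale assms(1))
qed

end


section \<open>The algebra \<open>H\<^sub>\<lambda>\<close>\<close>

lemma free_ring_simps [simp]:
  "carrier free_ring = UNIV" "p \<otimes>\<^bsub>free_ring\<^esub> q = p * q" "p \<oplus>\<^bsub>free_ring\<^esub> q = p + q"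
  "\<one>\<^bsub>free_ring\<^esub> = 1" "\<zero>\<^bsub>free_ring\<^esub> = 0"
  by (simp_all add: free_ring_def)

lemma ring_free_ring: "Ring.ring (free_ring :: 'k::field free_algebra Ring.ring)"
proof (rule ringI)
  show "abelian_group (free_ring :: 'k free_algebra Ring.ring)"
    by (rule abelian_groupI) (auto simp: algebra_simps intro: exI[of _ "- _"] left_minus)
  show "Group.monoid (free_ring :: 'k free_algebra Ring.ring)"
    by (rule monoidI) (simp_all add: mult.assoc)
qed (simp_all add: algebra_simps)

lemma ideal_H_ideal: "ideal (H_ideal N M lam) free_ring"
  unfolding H_ideal_def by (rule ring.genideal_ideal[OF ring_free_ring]) simp

lemma H_class_hom: "ring_hom_ring free_ring (H_alg N M lam) (H_class N M lam)"
  unfolding H_alg_def H_class_def[abs_def] by (rule ideal.rcos_ring_hom_ring[OF ideal_H_ideal])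

lemma carrier_H_alg: "carrier (H_alg N M lam) = range (H_class N M lam)"
  by (auto simp: H_alg_def H_class_def FactRing_def A_RCOSETS_def')

lemma const_elt_central: "const_elt c * p = p * const_elt c"
proof (induction p rule: poly_mapping_additive_induct)
qed (simp_all add: const_elt_def mult_single algebra_simps)

lemma assoc_algebra_H_alg: "assoc_algebra (H_alg N M lam) (H_unit N M lam)"
proof -
  interpret h: ring_hom_ring free_ring "H_alg N M lam" "H_class N M lam"
    by (rule H_class_hom)
  show ?thesis
  proof (unfold_locales)
    show "H_unit N M lam c \<in> carrier (H_alg N M lam)" for c
      by (simp add: H_unit_def carrier_H_alg)
    show "H_unit N M lam (c + d) = H_unit N M lam c \<oplus>\<^bsub>H_alg N M lam\<^esub> H_unit N M lam d" for c d
      using h.hom_add[of "const_elt c" "const_elt d"] by (simp add: H_unit_def const_elt_def single_add)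
    show "H_unit N M lam (c * d) = H_unit N M lam c \<otimes>\<^bsub>H_alg N M lam\<^esub> H_unit N M lam d" for c d
      using h.hom_mult[of "const_elt c" "const_elt d"] by (simp add: H_unit_def const_elt_def mult_single)
    show "H_unit N M lam 1 = \<one>\<^bsub>H_alg N M lam\<^esub>"
      using h.hom_one by (simp add: H_unit_def const_elt_def)
    fix a c assume "a \<in> carrier (H_alg N M lam)"
    then obtain p where a: "a = H_class N M lam p" by (auto simp: carrier_H_alg)
    show "H_unit N M lam c \<otimes>\<^bsub>H_alg N M lam\<^esub> a = a \<otimes>\<^bsub>H_alg N M lam\<^esub> H_unit N M lam c"
      using h.hom_mult[of "const_elt c" p] h.hom_mult[of p "const_elt c"]
      by (simp add: H_unit_def a const_elt_central)
  qed
qed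


section \<open>The generators on the ambient space\<close>

lemma lookup_xvec: "Poly_Mapping.lookup (xvec i j) x = (if x = (i, j) then 1 else 0)"
  by (simp add: xvec_def lookup_single when_def)

lemma lookup_gen_op:
  "Poly_Mapping.lookup (gen_op k \<chi> g v) x =
    (\<Sum>b\<in>Poly_Mapping.keys v. Poly_Mapping.lookup v b * Poly_Mapping.lookup (gen_on_x k \<chi> g b) x)"
  by (simp add: gen_op_def lookup_sum)

lemma sum_keys_delta:
  fixes v :: "'a \<Rightarrow>\<^sub>0 'b::semiring_0"
  shows "(\<Sum>b\<in>Poly_Mapping.keys v. Poly_Mapping.lookup v b * (if b = y then c else 0)) =
    Poly_Mapping.lookup v y * c"
proof -
  have "(\<Sum>b\<in>Poly_Mapping.keys v. Poly_Mapping.lookup v b * (if b = y then c else 0)) =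
    (\<Sum>b\<in>Poly_Mapping.keys v. if b = y then Poly_Mapping.lookup v b * c else 0)"
    by (intro sum.cong) auto
  then show ?thesis by (simp add: in_keys_iff)
qed

lemma lookup_gen_op_G1 [simp]:
  "Poly_Mapping.lookup (gen_op k \<chi> G1 v) (i, j) = fst (x_type \<chi> i) * Poly_Mapping.lookup v (i, j)"
proof -
  have "Poly_Mapping.lookup (gen_on_x k \<chi> G1 b) (i, j) = (if b = (i, j) then fst (x_type \<chi> i) else 0)" for b
    by (cases b) (auto simp: lookup_xvec)
  then show ?thesis unfolding lookup_gen_op by (simp add: sum_keys_delta mult.commute)
qed

lemma lookup_gen_op_G2 [simp]:
  "Poly_Mapping.lookup (gen_op k \<chi> G2 v) (i, j) = snd (x_type \<chi> i) * Poly_Mapping.lookup v (i, j)"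
proof -
  have "Poly_Mapping.lookup (gen_on_x k \<chi> G2 b) (i, j) = (if b = (i, j) then snd (x_type \<chi> i) else 0)" for b
    by (cases b) (auto simp: lookup_xvec)
  then show ?thesis unfolding lookup_gen_op by (simp add: sum_keys_delta mult.commute)
qed

lemma lookup_gen_op_A1 [simp]:
  "Poly_Mapping.lookup (gen_op k \<chi> A1 v) (i, j) =
    (if i = 1 then Poly_Mapping.lookup v (2, j) else if i = 3 then Poly_Mapping.lookup v (4, j) else 0)"
proof -
  \<comment> \<open>The alternative \<open>(4, j)\<close> is the true source only for
    \<open>i = 3\<close>; for \<open>i\<close> other than 1 and 3 it is a dummy, made harmless by
    the inner value 0.\<close>
  have "Poly_Mapping.lookup (gen_on_x k \<chi> A1 b) (i, j) =
    (if b = (if i = 1 then (2, j) else (4, j)) then if i = 1 \<or> i = 3 then 1 else 0 else 0)" for b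
    by (cases b) (auto simp: lookup_xvec)
  then show ?thesis unfolding lookup_gen_op by (simp add: sum_keys_delta)
qed

text \<open>The bound \<open>j \<le> k\<close> encodes that \<open>x\<^sub>1\<close> of block k+1 is
  0. The guard \<open>0 < j\<close> matters because \<open>j - 1\<close> is truncated: without it,
  position \<open>(1, 0)\<close> would read \<open>(4, 0)\<close>.\<close>

lemma lookup_gen_op_A2 [simp]:
  "Poly_Mapping.lookup (gen_op k \<chi> A2 v) (i, j) =
    (if i = 2 then Poly_Mapping.lookup v (3, j)
     else if i = 1 \<and> 0 < j \<and> j \<le> k then Poly_Mapping.lookup v (4, j - 1) else 0)"
proof -
  have "Poly_Mapping.lookup (gen_on_x k \<chi> A2 b) (i, j) =
    (if b = (if i = 2 then (3, j) else (4, j - 1)) then if i = 2 \<or> i = 1 \<and> 0 < j \<and> j \<le> k then 1 else 0 else 0)" for b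
    by (cases b) (auto simp: lookup_xvec)
  then show ?thesis unfolding lookup_gen_op by (simp add: sum_keys_delta)
qed

lemma linear_gen_op: "Vector_Spaces.linear vscale vscale (gen_op k \<chi> g)"
proof (unfold_locales)
  show "gen_op k \<chi> g (v + w) = gen_op k \<chi> g v + gen_op k \<chi> g w" for v w
    by (rule poly_mapping_eqI; cases g) (auto simp: lookup_add algebra_simps)
  show "gen_op k \<chi> g (vscale c v) = vscale c (gen_op k \<chi> g v)" for c v
    by (rule poly_mapping_eqI; cases g) (auto simp: algebra_simps)
qed

section \<open>The defining relations on the ambient space\<close>

lemma lookup_gen_op_G1_power:
  "Poly_Mapping.lookup ((gen_op k \<chi> G1 ^^ m) v) (i, j) = fst (x_type \<chi> i) ^ m * Poly_Mapping.lookup v (i, j)"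
  by (induction m) simp_all

lemma lookup_gen_op_G2_power:
  "Poly_Mapping.lookup ((gen_op k \<chi> G2 ^^ m) v) (i, j) = snd (x_type \<chi> i) ^ m * Poly_Mapping.lookup v (i, j)"
  by (induction m) simp_all

text \<open>The arrows change the signs of the types as the commutation rules require. The squares
  of \<open>A1\<close> and \<open>A2\<close> and both alternating words of length four act as zero;
  the matching right-hand sides involve only squares of the type entries, which do not see the
  signs, and vanish because \<chi> lies in \<open>char_set1\<close>.\<close>

lemma free_act_relators:
  assumes "\<chi> \<in> char_set1 N M lam" "p \<in> relators N M lam"
  shows "free_act (gen_op k \<chi>) p v = 0"
proof -
  obtain c1 c2 l1 l2 l3 where eq: "\<chi> = (c1, c2)" "lam = (l1, l2, l3)"
    by (metis surj_pair)
  have c: "c1 ^ (2 * N) = 1" "c2 ^ (2 * M) = 1" "l1 * (1 - c1 ^ 2) = 0" "l2 * (1 - c2 ^ 2) = 0"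
    "l3 * (1 - c1 ^ 2 * c2 ^ 2) - 2 * l1 * l2 * (1 + c2 ^ 2) * (1 - c1 ^ 2) = 0"
    using assms(1) by (auto simp: eq char_set1_def char_set_def)
  have t: "fst (x_type \<chi> i) = c1 \<or> fst (x_type \<chi> i) = - c1"
    "snd (x_type \<chi> i) = c2 \<or> snd (x_type \<chi> i) = - c2" for i
    by (auto simp: x_type_def bar_char_def eq)
  have t2: "fst (x_type \<chi> i) ^ (2 * n) = c1 ^ (2 * n)" "snd (x_type \<chi> i) ^ (2 * n) = c2 ^ (2 * n)" for i n
    using t[of i] by (auto simp: power_mult)
  note t3 = t2[where n = 1, simplified]
  have sq: "f ^ 2 = f * f" for f :: "'a free_algebra" by (rule power2_eq_square)
  note fa = free_act_diff free_act_uminus free_act_add free_act_mult[OF linear_gen_op]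
  show ?thesis
    using assms(2) unfolding relators_def eq(2) Let_def case_prod_conv insert_iff empty_iff
  proof (elim disjE, goal_cases)
    case 1
    then show ?case
      by (auto intro!: poly_mapping_eqI simp: fa lookup_minus)
  next
    case 2
    then show ?case
      by (auto intro!: poly_mapping_eqI simp: fa free_act_power[OF linear_gen_op] lookup_minus
          lookup_gen_op_G1_power t2 c free_act_gen_elt[abs_def])
  next
    case 3
    then show ?case
      by (auto intro!: poly_mapping_eqI simp: fa free_act_power[OF linear_gen_op] lookup_minus
          lookup_gen_op_G2_power t2 c free_act_gen_elt[abs_def])
  next
    case 4
    then show ?case
      by (auto intro!: poly_mapping_eqI simp: fa lookup_minus lookup_add x_type_def bar_char_def)
  next
    case 5
    then show ?case
      by (auto intro!: poly_mapping_eqI simp: fa lookup_minus lookup_add x_type_def bar_char_def)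
  next
    case 6
    then show ?case
      by (auto intro!: poly_mapping_eqI simp: fa lookup_minus lookup_add x_type_def bar_char_def)
  next
    case 7
    then show ?case
      by (auto intro!: poly_mapping_eqI simp: fa lookup_minus lookup_add x_type_def bar_char_def)
  next
    case 8
    have "l1 * (y - fst (x_type \<chi> i) * (fst (x_type \<chi> i) * y)) = l1 * (1 - c1 ^ 2) * y" for i y
      unfolding t3(1)[of i, symmetric] by (simp add: algebra_simps power2_eq_square)
    then show ?case using 8
      by (auto intro!: poly_mapping_eqI simp: fa lookup_minus lookup_add sq c)
  next
    case 9
    have "l2 * (y - snd (x_type \<chi> i) * (snd (x_type \<chi> i) * y)) = l2 * (1 - c2 ^ 2) * y" for i y
      unfolding t3(2)[of i, symmetric] by (simp add: algebra_simps power2_eq_square)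
    then show ?case using 9
      by (auto intro!: poly_mapping_eqI simp: fa lookup_minus lookup_add sq c)
  next
    case 10
    \<comment> \<open>With the alternating words gone, only the right-hand side is left, in the
      nested form that successive application of the group generators produces.\<close>
    have *: "l3 * (y - x1 * (x1 * (x2 * (x2 * y)))) -
        2 * l1 * l2 * (y - x1 * (x1 * y) + x2 * (x2 * (y - x1 * (x1 * y)))) = 0"
      if "x1 = fst (x_type \<chi> i)" "x2 = snd (x_type \<chi> i)" for i y x1 x2
    proof -
      have "l3 * (y - x1 * (x1 * (x2 * (x2 * y)))) -
        2 * l1 * l2 * (y - x1 * (x1 * y) + x2 * (x2 * (y - x1 * (x1 * y)))) =
        (l3 * (1 - x1 ^ 2 * x2 ^ 2) - 2 * l1 * l2 * (1 + x2 ^ 2) * (1 - x1 ^ 2)) * y"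
        by (simp add: algebra_simps power2_eq_square)
      then show ?thesis using c(5) t3[of i] that by simp
    qed
    show ?case unfolding 10
      by (rule poly_mapping_eqI) (auto simp: fa lookup_minus lookup_add sq * simp del: One_nat_def)
  qed simp
qed

text \<open>The elements annihilating the whole ambient space form a two-sided ideal; quantifying
  over every vector is what gives closure under multiplication on the right. It contains the
  relators, hence the ideal they generate.\<close>

lemma free_act_H_ideal:
  assumes "\<chi> \<in> char_set1 N M lam" "p \<in> H_ideal N M lam"
  shows "free_act (gen_op k \<chi>) p v = 0"
proof -
  interpret l: Vector_Spaces.linear vscale vscale "free_act (gen_op k \<chi>) q" for q
    by (rule linear_free_act[OF linear_gen_op])
  let ?I = "{p. \<forall>v. free_act (gen_op k \<chi>) p v = 0}"
  have "ideal ?I free_ring"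
  proof (rule idealI[OF ring_free_ring])
    have grp: "Group.group (add_monoid (free_ring :: 'a free_algebra Ring.ring))"
      by (rule abelian_group.a_group[OF ring.is_abelian_group[OF ring_free_ring]])
    show "subgroup ?I (add_monoid (free_ring :: 'a free_algebra Ring.ring))"
    proof (rule group.subgroupI[OF grp])
      show "inv\<^bsub>add_monoid free_ring\<^esub> p \<in> ?I" if "p \<in> ?I" for p :: "'a free_algebra"
      proof -
        have "inv\<^bsub>add_monoid free_ring\<^esub> p = - p"
          by (rule group.inv_equality[OF grp]) auto
        then show ?thesis using that by (simp add: free_act_uminus)
      qed
    qed (auto simp: free_act_add intro: exI[of _ 0])
  qed (auto simp: free_act_mult[OF linear_gen_op] l.zero)
  moreover have "relators N M lam \<subseteq> ?I"
    using free_act_relators[OF assms(1)] by auto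
  ultimately have "H_ideal N M lam \<subseteq> ?I"
    unfolding H_ideal_def by (rule ring.genideal_minimal[OF ring_free_ring])
  with assms(2) show ?thesis by auto
qed

text \<open>Representatives of a class differ by elements that act as zero, and the class is
  nonempty, so the set passed to \<open>the_elem\<close> is a singleton.\<close>

lemma Q_act_H_class:
  assumes "\<chi> \<in> char_set1 N M lam"
  shows "Q_act k \<chi> (H_class N M lam p) v = free_act (gen_op k \<chi>) p v"
proof -
  have ne: "0 \<in> H_ideal N M lam"
    using additive_subgroup.zero_closed[OF ideal.axioms(1)[OF ideal_H_ideal, of N M lam]] by simp
  have "H_class N M lam p = (\<lambda>h. h + p) ` H_ideal N M lam"
    by (auto simp: H_class_def a_r_coset_def' )
  then have "(\<lambda>p. free_act (gen_op k \<chi>) p v) ` H_class N M lam p = {free_act (gen_op k \<chi>) p v}"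
    using ne by (auto simp: free_act_add free_act_H_ideal[OF assms] image_image)
  then show ?thesis by (simp add: Q_act_def)
qed

section \<open>The spaces spanned by initial segments of the basis\<close>

text \<open>A single index, the position in the ordered basis, turns arrows into steps between
  neighbours. Positions \<open>(i, j)\<close> with i outside 1, ..., 4 or with j = 0 are invisible
  to it.\<close>

definition coord :: "'k::field vect \<Rightarrow> nat \<Rightarrow> 'k" where
  "coord v m = Poly_Mapping.lookup v (m mod 4 + 1, m div 4 + 1)"

lemma coord_linear [simp]:
  "coord (v + w) m = coord v m + coord w m" "coord (vscale c v) m = c * coord v m" "coord 0 m = 0"
  by (simp_all add: coord_def lookup_add)

lemma coord_sum: "coord (sum f S) m = (\<Sum>x\<in>S. coord (f x) m)"
  by (simp add: coord_def lookup_sum)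

lemma coord_basis_vec: "coord (basis_vec p) m = (if p = m then 1 else 0)"
proof -
  have "p = m" if "p mod 4 = m mod 4" "p div 4 = m div 4"
    using that by (metis div_mult_mod_eq)
  then show ?thesis by (auto simp: coord_def basis_vec_def lookup_xvec)
qed

lemma span_basis_vec_expansion:
  assumes "v \<in> vs.span (basis_vec ` {..<n})"
  shows "v = (\<Sum>m<n. vscale (coord v m) (basis_vec m))"
  using assms
proof (induction rule: vs.span_induct_alt)
  case base
  then show ?case by simp
next
  case (step c x y)
  then obtain p where p: "p < n" "x = basis_vec p" by auto
  have "(\<Sum>m<n. vscale (coord x m) (basis_vec m)) = (\<Sum>m<n. if m = p then x else 0)"
    by (intro sum.cong) (auto simp: p coord_basis_vec)
  then have x: "(\<Sum>m<n. vscale (coord x m) (basis_vec m)) = x" using p by simp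
  have "(\<Sum>m<n. vscale (coord (vscale c x + y) m) (basis_vec m)) =
    vscale c (\<Sum>m<n. vscale (coord x m) (basis_vec m)) + (\<Sum>m<n. vscale (coord y m) (basis_vec m))"
    by (simp add: vs.scale_left_distrib sum.distrib vs.scale_sum_right)
  then show ?case unfolding x using step by simp
qed

text \<open>The second index of a basis vector starts at 1. This matters because the formula for
  \<open>A2\<close> at \<open>(1, 1)\<close> may read position \<open>(4, 0)\<close>.\<close>

lemma lookup_span_basis_vec_0:
  assumes "v \<in> vs.span (basis_vec ` {..<n})"
  shows "Poly_Mapping.lookup v (i, 0) = 0"
  by (subst span_basis_vec_expansion[OF assms]) (simp add: lookup_sum basis_vec_def lookup_xvec)

lemma inj_basis_vec: "inj_on (basis_vec :: nat \<Rightarrow> 'k::field vect) S"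
proof (rule inj_onI)
  fix p m assume "(basis_vec p :: 'k vect) = basis_vec m"
  then have "coord (basis_vec p :: 'k vect) m = coord (basis_vec m) m" by simp
  then show "p = m" by (simp add: coord_basis_vec split: if_splits)
qed

text \<open>The coordinate at \<open>m\<close> vanishes on all other basis vectors, hence on their
  span, but not on \<open>basis_vec m\<close>.\<close>

lemma independent_basis_vec: "vs.independent (basis_vec ` S)"
  unfolding vs.dependent_def
proof safe
  fix m assume m: "basis_vec m \<in> vs.span (basis_vec ` S - {basis_vec m :: 'a vect})"
  have "vs.span (basis_vec ` S - {basis_vec m :: 'a vect}) \<subseteq> {v. coord v m = 0}"
    by (rule vs.span_minimal) (auto simp: coord_basis_vec intro!: vs.subspaceI)
  with m show False by (auto simp: coord_basis_vec)
qed

lemma dim_span_basis_vec: "vs.dim (vs.span (basis_vec ` {..<n} :: 'k::field vect set)) = n"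
  using vs.dim_span_eq_card_independent[OF independent_basis_vec, of "{..<n}"]
  by (simp add: card_image[OF inj_basis_vec] del: vs.dim_span)

text \<open>The generator that lowers \<open>basis_vec (Suc m)\<close> to \<open>basis_vec m\<close>
  inside a block of four. When 4 divides \<open>Suc m\<close> the arrow is reversed:
  \<open>A2\<close> takes \<open>basis_vec m\<close> up to \<open>basis_vec (Suc m)\<close>,
  provided the next block exists.\<close>

definition down_gen :: "nat \<Rightarrow> gen" where
  "down_gen m = (if even m then A1 else A2)"

lemma mod4_cases:
  fixes m :: nat
  obtains "m mod 4 = 0" | "m mod 4 = 1" | "m mod 4 = 2" | "m mod 4 = 3"
proof -
  have "m mod 4 = 0 \<or> m mod 4 = 1 \<or> m mod 4 = 2 \<or> m mod 4 = 3" by presburger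
  then show thesis by (elim disjE) (use that in \<open>simp_all\<close>)
qed

section \<open>The generators along the chain of basis vectors\<close>

lemma coord_gen_op_G:
  "coord (gen_op k \<chi> G1 v) m = fst (x_type \<chi> (m mod 4 + 1)) * coord v m"
  "coord (gen_op k \<chi> G2 v) m = snd (x_type \<chi> (m mod 4 + 1)) * coord v m"
  by (simp_all add: coord_def)

lemma even_iff_mod4: "even (m::nat) \<longleftrightarrow> m mod 4 = 0 \<or> m mod 4 = 2"
  by presburger

lemma coord_gen_op_down:
  assumes "Suc m mod 4 \<noteq> 0"
  shows "coord (gen_op k \<chi> (down_gen m) v) m = coord v (Suc m)"
proof -
  have "Suc m div 4 = m div 4" "Suc m mod 4 = m mod 4 + 1" "m mod 4 \<noteq> 3"
    using assms by presburger+
  then show ?thesis using assms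
    by (cases m rule: mod4_cases) (simp_all add: coord_def down_gen_def even_iff_mod4 del: One_nat_def)
qed

lemma coord_gen_op_up:
  assumes "Suc m mod 4 = 0" "Suc m < 4 * k"
  shows "coord (gen_op k \<chi> A2 v) (Suc m) = coord v m"
proof -
  have *: "Suc m div 4 = Suc (m div 4)" "m mod 4 = 3" "Suc (Suc (m div 4)) \<le> k"
    using assms by presburger+
  show ?thesis using * assms(1) by (simp add: coord_def)
qed

lemma gen_op_xvec: "gen_op k \<chi> g (xvec i j) = gen_on_x k \<chi> g (i, j)"
  by (simp add: gen_op_def xvec_def)

lemma gen_op_basis_vec_down:
  assumes "Suc m mod 4 \<noteq> 0"
  shows "gen_op k \<chi> (down_gen m) (basis_vec (Suc m)) = basis_vec m"
proof -
  have "Suc m div 4 = m div 4" "Suc m mod 4 = m mod 4 + 1" "m mod 4 \<noteq> 3"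
    using assms by presburger+
  then show ?thesis using assms
    by (cases m rule: mod4_cases) (simp_all add: basis_vec_def down_gen_def gen_op_xvec even_iff_mod4 del: One_nat_def)
qed

lemma gen_op_basis_vec_up:
  assumes "Suc m mod 4 = 0" "Suc m < 4 * k"
  shows "gen_op k \<chi> A2 (basis_vec m) = basis_vec (Suc m)"
proof -
  have *: "Suc m div 4 = Suc (m div 4)" "m mod 4 = 3" "Suc (m div 4) < k"
    using assms by presburger+
  show ?thesis using * assms(1) by (simp add: basis_vec_def gen_op_xvec)
qed

text \<open>Arrows inside a block lead to smaller indices. An ascending arrow could leave the
  segment only from \<open>n - 1\<close> with 4 dividing \<open>n\<close>; then the bounds force
  \<open>n = 4 * k\<close>, where the arrow is cut off.\<close>

lemma gen_op_span_basis_vec: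
  assumes n: "n \<le> 4 * k" "4 * k < n + 4" and v: "v \<in> vs.span (basis_vec ` {..<n})"
  shows "gen_op k \<chi> g v \<in> vs.span (basis_vec ` {..<n})"
  using v
proof (induction rule: vs.span_induct_alt)
  case base
  interpret l: Vector_Spaces.linear vscale vscale "gen_op k \<chi> g" by (rule linear_gen_op)
  show ?case by (simp add: l.zero vs.span_zero)
next
  case (step c x y)
  interpret l: Vector_Spaces.linear vscale vscale "gen_op k \<chi> g" by (rule linear_gen_op)
  from step obtain m where m: "m < n" "x = basis_vec m" by auto
  have b: "basis_vec p \<in> vs.span (basis_vec ` {..<n})" if "p < n" for p
    using that by (intro vs.span_base) auto
  have "gen_op k \<chi> g (basis_vec m) \<in> vs.span (basis_vec ` {..<n})"
  proof (cases "g = G1 \<or> g = G2")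
    case True
    then show ?thesis
      using b[OF m(1)] by (auto simp: basis_vec_def gen_op_xvec intro!: vs.span_scale)
  next
    case False
    consider "gen_op k \<chi> g (basis_vec m) = 0" | p where "m = Suc p" "g = down_gen p" "Suc p mod 4 \<noteq> 0"
      | "g = A2" "m mod 4 = 3" "m div 4 + 1 < k"
    proof (cases m rule: mod4_cases)
      case 1
      then show ?thesis using False that(1) by (cases g) (auto simp: basis_vec_def gen_op_xvec)
    next
      case 2
      then have "m = Suc (m - 1)" "even (m - 1)" by presburger+
      then show ?thesis
        using False 2 that(1) that(2)[of "m - 1"]
        by (cases g) (auto simp: basis_vec_def gen_op_xvec down_gen_def)
    next
      case 3
      then have "m = Suc (m - 1)" "odd (m - 1)" by presburger+
      then show ?thesis
        using False 3 that(1) that(2)[of "m - 1"]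
        by (cases g) (auto simp: basis_vec_def gen_op_xvec down_gen_def)
    next
      case 4
      then have "m = Suc (m - 1)" "even (m - 1)" by presburger+
      then show ?thesis
        using False 4 that(1,3) that(2)[of "m - 1"]
        by (cases g; cases "m div 4 + 1 < k") (auto simp: basis_vec_def gen_op_xvec down_gen_def)
    qed
    then show ?thesis
    proof cases
      case 1
      then show ?thesis by (simp add: vs.span_zero)
    next
      case 2
      then show ?thesis using m b[of p] by (simp add: gen_op_basis_vec_down)
    next
      case 3
      then have "Suc m mod 4 = 0" "Suc m < 4 * k" by presburger+
      moreover from this have "Suc m < n" using n by presburger
      ultimately show ?thesis using 3 b by (simp add: gen_op_basis_vec_up)
    qed
  qed
  then show ?case using step.IH m
    by (simp add: l.add l.scale vs.span_add vs.span_scale)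
qed


section \<open>Indecomposability\<close>

text \<open>The four types realize the four sign choices of the entries of \<chi>, and a nonzero
  scalar differs from its negative in characteristic zero.\<close>

lemma x_type_inj:
  fixes \<chi> :: "'k::field_char_0 \<times> 'k"
  assumes "fst \<chi> \<noteq> 0" "snd \<chi> \<noteq> 0" "x_type \<chi> (p mod 4 + 1) = x_type \<chi> (m mod 4 + 1)"
  shows "p mod 4 = m mod 4"
  using assms
  by (cases \<chi>; cases p rule: mod4_cases; cases m rule: mod4_cases)
    (auto simp: x_type_def bar_char_def)

lemma string_decomposition_trivial:
  fixes \<chi> :: "'k::field_char_0 \<times> 'k"
  assumes \<chi>: "fst \<chi> \<noteq> 0" "snd \<chi> \<noteq> 0" and n: "n \<le> 4 * k"
    and U: "vs.subspace U" "\<And>g u. u \<in> U \<Longrightarrow> gen_op k \<chi> g u \<in> U"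
    and W: "vs.subspace W" "\<And>g w. w \<in> W \<Longrightarrow> gen_op k \<chi> g w \<in> W"
    and UW: "U \<inter> W = {0}" "{u + w | u w. u \<in> U \<and> w \<in> W} = vs.span (basis_vec ` {..<n})"
  shows "U = {0} \<or> W = {0}"
proof -
  let ?V = "vs.span (basis_vec ` {..<n} :: 'k vect set)"
  interpret l: Vector_Spaces.linear vscale vscale "gen_op k \<chi> g" for g by (rule linear_gen_op)
  have unique: "u = u'" if "u \<in> U" "u' \<in> U" "w \<in> W" "w' \<in> W" "u + w = u' + w'" for u u' w w'
  proof -
    have "u - u' = w' - w" using that(5) by (simp add: algebra_simps)
    moreover have "u - u' \<in> U" "w' - w \<in> W" using that U(1) W(1) by (simp_all add: vs.subspace_diff)
    ultimately have "u - u' \<in> U \<inter> W" by simp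
    then show ?thesis using UW(1) by simp
  qed
  have "\<exists>u w. u \<in> U \<and> w \<in> W \<and> basis_vec m = u + w" if "m < n" for m
  proof -
    have "basis_vec m \<in> ?V" using that by (intro vs.span_base) auto
    then show ?thesis unfolding UW(2)[symmetric] by blast
  qed
  then obtain u w where uw: "\<And>m. m < n \<Longrightarrow> u m \<in> U \<and> w m \<in> W \<and> basis_vec m = u m + w m"
    by metis
  have sub: "U \<subseteq> ?V" "W \<subseteq> ?V"
    unfolding UW(2)[symmetric] using vs.subspace_0[OF U(1)] vs.subspace_0[OF W(1)]
    by (force, force)
  \<comment> \<open>The projection onto \<open>U\<close> is handled through its values
    \<open>u m\<close> alone; that it commutes with \<open>g\<close> is uniqueness of components,
    \<open>U\<close> and \<open>W\<close> being stable.\<close>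
  have transport: "gen_op k \<chi> g (u m) = vscale c (u p)"
    if "m < n" "p < n" "gen_op k \<chi> g (basis_vec m) = vscale c (basis_vec p)" for g m p c
  proof (rule unique)
    show "gen_op k \<chi> g (u m) + gen_op k \<chi> g (w m) = vscale c (u p) + vscale c (w p)"
      using that uw by (metis l.add vs.scale_right_distrib)
  qed (use that uw U W in \<open>auto intro: vs.subspace_scale\<close>)
  have mod4: "coord (u m) p = 0" if "m < n" "p mod 4 \<noteq> m mod 4" for m p
  proof (rule ccontr)
    assume nz: "coord (u m) p \<noteq> 0"
    have "gen_op k \<chi> G1 (u m) = vscale (fst (x_type \<chi> (m mod 4 + 1))) (u m)"
      "gen_op k \<chi> G2 (u m) = vscale (snd (x_type \<chi> (m mod 4 + 1))) (u m)"
      using that by (auto intro!: transport simp: basis_vec_def gen_op_xvec)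
    then have "x_type \<chi> (p mod 4 + 1) = x_type \<chi> (m mod 4 + 1)"
      using coord_gen_op_G[of k \<chi> "u m" p] nz by (simp add: prod_eq_iff)
    then show False using x_type_inj[OF \<chi>] that by blast
  qed
  define c where "c = coord (u 0) 0"
  have tri: "coord (u m) m = c \<and> (\<forall>p<m. coord (u m) p = 0)" if "m < n" for m
    using that
  proof (induction m)
    case 0
    then show ?case by (simp add: c_def)
  next
    case (Suc m)
    \<comment> \<open>Since \<open>p\<close> and \<open>m\<close> agree modulo 4, one generator
      serves both. Whether it maps \<open>u m\<close> up or \<open>u (Suc m)\<close> down, reading
      one coordinate of the image gives the shift.\<close>
    have shift: "coord (u (Suc m)) (Suc p) = coord (u m) p" if p: "Suc p mod 4 = Suc m mod 4" "p \<le> m" for p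
    proof (cases "Suc m mod 4 = 0")
      case True
      have "gen_op k \<chi> A2 (u m) = vscale 1 (u (Suc m))"
        using Suc.prems True n by (intro transport) (simp_all add: gen_op_basis_vec_up)
      then show ?thesis using coord_gen_op_up[of p k \<chi> "u m"] True p Suc.prems n by simp
    next
      case False
      have "gen_op k \<chi> (down_gen m) (u (Suc m)) = vscale 1 (u m)"
        using Suc.prems False by (intro transport) (simp_all add: gen_op_basis_vec_down)
      moreover have "down_gen m = down_gen p" using p by (simp add: down_gen_def) presburger
      ultimately show ?thesis using coord_gen_op_down[of p k \<chi> "u (Suc m)"] False p by simp
    qed
    have "coord (u (Suc m)) p = 0" if p: "p < Suc m" for p
    proof (cases "p mod 4 = Suc m mod 4")
      case False
      then show ?thesis using mod4 Suc.prems by simp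
    next
      case True
      show ?thesis
      proof (cases p)
        \<comment> \<open>Index 0 has no predecessor to shift from. Here 4 divides
          \<open>Suc m\<close>, so \<open>u (Suc m)\<close> is the image of \<open>u m\<close> under
          \<open>A2\<close>, and its coefficient at \<open>basis_vec 0\<close> could only come from
          position \<open>(4, 0)\<close>, outside the basis.\<close>
        case 0
        have m: "u m \<in> ?V" using uw Suc.prems sub by auto
        have "gen_op k \<chi> A2 (u m) = vscale 1 (u (Suc m))"
          using Suc.prems True 0 n by (intro transport) (simp_all add: gen_op_basis_vec_up)
        then have "coord (u (Suc m)) 0 = coord (gen_op k \<chi> A2 (u m)) 0" by simp
        also have "\<dots> = 0" using lookup_span_basis_vec_0[OF m] by (simp add: coord_def)
        finally show ?thesis using 0 by simp
      next
        case (Suc q)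
        then show ?thesis using shift[of q] True p Suc.IH Suc.prems by simp
      qed
    qed
    then show ?case using shift[of m] Suc.IH Suc.prems by simp
  qed
  have vanish: "v = 0"
    if v: "v \<in> ?V" and z: "\<And>m. m < n \<Longrightarrow> (\<And>p. p < m \<Longrightarrow> coord v p = 0) \<Longrightarrow> coord v m = 0" for v
  proof -
    have "coord v m = 0" if "m < n" for m
      using that
    proof (induction m rule: less_induct)
      case (less m)
      show ?case by (rule z[OF less.prems]) (use less in simp)
    qed
    then show ?thesis by (subst span_basis_vec_expansion[OF v]) simp
  qed
  have expand: "(\<Sum>m<n. vscale (coord v m) (u m)) + (\<Sum>m<n. vscale (coord v m) (w m)) = v"
    "(\<Sum>m<n. vscale (coord v m) (u m)) \<in> U" "(\<Sum>m<n. vscale (coord v m) (w m)) \<in> W"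
    if "v \<in> ?V" for v
  proof -
    have "(\<Sum>m<n. vscale (coord v m) (u m)) + (\<Sum>m<n. vscale (coord v m) (w m)) =
      (\<Sum>m<n. vscale (coord v m) (u m + w m))"
      by (simp add: vs.scale_right_distrib sum.distrib)
    also have "\<dots> = (\<Sum>m<n. vscale (coord v m) (basis_vec m))"
      using uw by (intro sum.cong) auto
    finally show "(\<Sum>m<n. vscale (coord v m) (u m)) + (\<Sum>m<n. vscale (coord v m) (w m)) = v"
      using span_basis_vec_expansion[OF that] by simp
  qed (use uw U(1) W(1) in \<open>auto intro!: vs.subspace_sum vs.subspace_scale\<close>)
  \<comment> \<open>Terms with \<open>p < m\<close> drop out since \<open>coord v p = 0\<close>,
    those with \<open>p > m\<close> since \<open>u p\<close> has no coefficient before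
    \<open>p\<close>; the diagonal term contributes \<open>c\<close>.\<close>
  have lead: "coord (\<Sum>m<n. vscale (coord v m) (u m)) m = coord v m * c"
    if "m < n" "\<And>p. p < m \<Longrightarrow> coord v p = 0" for v m
  proof -
    have "coord v p * coord (u p) m = (if p = m then coord v m * c else 0)" if "p < n" for p
      using tri[OF that] \<open>\<And>p. p < m \<Longrightarrow> coord v p = 0\<close> by (cases p m rule: linorder_cases) auto
    then show ?thesis using that(1) by (simp add: coord_sum)
  qed
  show ?thesis
  proof (cases "c = 0")
    case True
    have "v = 0" if "v \<in> U" for v
    proof (rule vanish)
      show V: "v \<in> ?V" using that sub by auto
      \<comment> \<open>A vector of \<open>U\<close> is its own component in \<open>U\<close>, so
        its leading coefficient is a multiple of \<open>c = 0\<close>.\<close>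
      have "v = (\<Sum>m<n. vscale (coord v m) (u m))"
        using expand[OF V] that vs.subspace_0[OF W(1)]
        by (intro unique[of v _ 0]) auto
      then show "coord v m = 0" if "m < n" "\<And>p. p < m \<Longrightarrow> coord v p = 0" for m
        using lead[of m v] that True by simp
    qed
    then show ?thesis using vs.subspace_0[OF U(1)] by auto
  next
    case False
    have "v = 0" if "v \<in> W" for v
    proof (rule vanish)
      show V: "v \<in> ?V" using that sub by auto
      \<comment> \<open>A vector of \<open>W\<close> has component 0 in \<open>U\<close>, so its
        leading coefficient times the nonzero \<open>c\<close> is 0.\<close>
      have "0 = (\<Sum>m<n. vscale (coord v m) (u m))"
        using expand[OF V] that vs.subspace_0[OF U(1)]
        by (intro unique[of 0 _ v]) auto
      then show "coord v m = 0" if "m < n" "\<And>p. p < m \<Longrightarrow> coord v p = 0" for m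
        using lead[of m v] that False by (metis coord_linear(3) mult_eq_0_iff)
    qed
    then show ?thesis using vs.subspace_0[OF W(1)] by auto
  qed
qed


section \<open>The modules \<open>Q\<^sub>n\<^sup>\<chi>\<close>\<close>

text \<open>Combinations of words keep every subspace that each generator keeps; conversely the
  class of a generator acts as \<open>gen_op\<close>. This puts submodules into the form treated by
  \<open>string_decomposition_trivial\<close>.\<close>

lemma submodule_iff:
  assumes "\<chi> \<in> char_set1 N M lam"
  shows "submodule (H_alg N M lam) vscale V (Q_act k \<chi>) W \<longleftrightarrow>
    W \<subseteq> V \<and> vs.subspace W \<and> (\<forall>g. \<forall>w\<in>W. gen_op k \<chi> g w \<in> W)"
proof -
  note Q = Q_act_H_class[OF assms]
  have "(\<forall>a\<in>carrier (H_alg N M lam). \<forall>w\<in>W. Q_act k \<chi> a w \<in> W) \<longleftrightarrow>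
    (\<forall>g. \<forall>w\<in>W. gen_op k \<chi> g w \<in> W)" if W: "vs.subspace W"
  proof
    assume *: "\<forall>a\<in>carrier (H_alg N M lam). \<forall>w\<in>W. Q_act k \<chi> a w \<in> W"
    have "Q_act k \<chi> (H_class N M lam (gen_elt g)) w \<in> W" if "w \<in> W" for g w
      using * that by (simp add: carrier_H_alg)
    then show "\<forall>g. \<forall>w\<in>W. gen_op k \<chi> g w \<in> W" by (simp add: Q)
  next
    assume "\<forall>g. \<forall>w\<in>W. gen_op k \<chi> g w \<in> W"
    then show "\<forall>a\<in>carrier (H_alg N M lam). \<forall>w\<in>W. Q_act k \<chi> a w \<in> W"
      using W by (auto simp: carrier_H_alg Q intro: free_act_closed[OF linear_gen_op])
  qed
  then show ?thesis unfolding submodule_def by blast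
qed

lemma algebra_module_Q_act:
  assumes "\<chi> \<in> char_set1 N M lam" "vs.subspace V" "\<And>g v. v \<in> V \<Longrightarrow> gen_op k \<chi> g v \<in> V"
  shows "algebra_module (H_alg N M lam) (H_unit N M lam) vscale V (Q_act k \<chi>)"
proof -
  interpret h: ring_hom_ring free_ring "H_alg N M lam" "H_class N M lam"
    by (rule H_class_hom)
  interpret l: Vector_Spaces.linear vscale vscale "free_act (gen_op k \<chi>) p" for p
    by (rule linear_free_act[OF linear_gen_op])
  note Q = Q_act_H_class[OF assms(1)]
  show ?thesis
  proof (intro algebra_module.intro algebra_module_axioms.intro assoc_algebra_H_alg
      vector_space_vscale assms(2), unfold carrier_H_alg, safe)
    show "Q_act k \<chi> (H_class N M lam p) v \<in> V" if "v \<in> V" for p v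
      unfolding Q using that assms(2,3) by (intro free_act_closed[OF linear_gen_op])
    show "Q_act k \<chi> (H_class N M lam p \<oplus>\<^bsub>H_alg N M lam\<^esub> H_class N M lam q) v =
      Q_act k \<chi> (H_class N M lam p) v + Q_act k \<chi> (H_class N M lam q) v" for p q v
      using h.hom_add[of p q] Q[of k "p + q" v] by (simp add: Q free_act_add)
    show "Q_act k \<chi> (H_class N M lam p \<otimes>\<^bsub>H_alg N M lam\<^esub> H_class N M lam q) v =
      Q_act k \<chi> (H_class N M lam p) (Q_act k \<chi> (H_class N M lam q) v)" for p q v
      using h.hom_mult[of p q] Q[of k "p * q" v] by (simp add: Q free_act_mult[OF linear_gen_op])
  qed (simp_all add: Q l.add H_unit_def)
qed

lemma Q_blocks_bounds: "n \<le> 4 * Q_blocks n" "4 * Q_blocks n < n + 4"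
  unfolding Q_blocks_def by (auto, presburger+)

text \<open>The span of the initial segment is already a submodule, so generating adds nothing;
  conversely, every submodule containing the segment contains its span.\<close>

lemma Q_space_eq_span:
  assumes "\<chi> \<in> char_set1 N M lam"
  shows "Q_space N M lam \<chi> n = vs.span (basis_vec ` {..<n})"
proof (cases "n mod 4 = 0")
  case True
  then have "4 * (n div 4) = n" by presburger
  then show ?thesis using True by (simp add: Q_space_def Q4_space_def)
next
  case False
  let ?k = "n div 4 + 1"
  have k: "n \<le> 4 * ?k" "4 * ?k < n + 4"
    using Q_blocks_bounds[of n] False by (simp_all add: Q_blocks_def)
  have "submodule (H_alg N M lam) vscale (Q4_space ?k) (Q_act ?k \<chi>) (vs.span (basis_vec ` {..<n}))"
    unfolding submodule_iff[OF assms] Q4_space_def using k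
    by (auto intro!: gen_op_span_basis_vec vs.span_mono)
  then have "generated_submodule (H_alg N M lam) vscale (Q4_space ?k) (Q_act ?k \<chi>) (basis_vec ` {..<n}) =
    vs.span (basis_vec ` {..<n})"
    unfolding generated_submodule_def
    by (auto simp: vs.span_superset submodule_def dest: vs.span_minimal)
  then show ?thesis using False by (simp add: Q_space_def)
qed

theorem lemma6p10:
  fixes N M n :: nat
    and lam :: "'k::{alg_closed_field, field_char_0} \<times> 'k \<times> 'k"
    and \<chi> :: "'k \<times> 'k"
  assumes "N \<ge> 2" and "M \<ge> 2" and "n \<ge> 1"
    and "\<chi> \<in> char_set1 N M lam"
  shows "let A = H_alg N M lam; V = Q_space N M lam \<chi> n; act = Q_act (Q_blocks n) \<chi>
    in algebra_module A (H_unit N M lam) vscale V act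
      \<and> (\<forall>g. \<forall>v\<in>V. act (H_class N M lam (gen_elt g)) v = gen_op (Q_blocks n) \<chi> g v)
      \<and> indecomposable A vscale V act
      \<and> vector_space.dim vscale V = n"
proof -
  let ?k = "Q_blocks n" and ?V = "vs.span (basis_vec ` {..<n} :: 'k vect set)"
  note \<chi> = assms(4)
  \<comment> \<open>Roots of unity are nonzero, the exponents \<open>2 * N\<close> and
    \<open>2 * M\<close> being positive.\<close>
  have nz: "fst \<chi> \<noteq> 0" "snd \<chi> \<noteq> 0"
    using \<chi> assms(1,2) by (auto simp: char_set1_def char_set_def power_0_left)
  have closed: "gen_op ?k \<chi> g v \<in> ?V" if "v \<in> ?V" for g v
    using that by (rule gen_op_span_basis_vec[OF Q_blocks_bounds])
  \<comment> \<open>The space is nonzero because \<open>n \<ge> 1\<close> puts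
    \<open>basis_vec 0\<close> into it.\<close>
  have "(basis_vec 0 :: 'k vect) \<in> ?V" using assms(3) by (intro vs.span_base) auto
  moreover have "coord (basis_vec 0 :: 'k vect) 0 \<noteq> coord 0 0" by (simp add: coord_basis_vec)
  ultimately have "?V \<noteq> {0}" by (metis singletonD)
  moreover have "U = {0} \<or> W = {0}"
    if "submodule (H_alg N M lam) vscale ?V (Q_act ?k \<chi>) U"
      "submodule (H_alg N M lam) vscale ?V (Q_act ?k \<chi>) W"
      "U \<inter> W = {0}" "{u + w | u w. u \<in> U \<and> w \<in> W} = ?V" for U W
    using that(1,2) unfolding submodule_iff[OF \<chi>]
    by (intro string_decomposition_trivial[OF nz Q_blocks_bounds(1) _ _ _ _ that(3,4)]) simp_all
  ultimately have "indecomposable (H_alg N M lam) vscale ?V (Q_act ?k \<chi>)"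
    unfolding indecomposable_def by simp
  moreover have "Q_act ?k \<chi> (H_class N M lam (gen_elt g)) v = gen_op ?k \<chi> g v" for g v
    by (simp add: Q_act_H_class[OF \<chi>])
  ultimately show ?thesis
    unfolding Let_def Q_space_eq_span[OF \<chi>] dim_span_basis_vec
    using algebra_module_Q_act[OF \<chi> vs.subspace_span closed] by simp
qed

end
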